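(* Let $\mathcal F=\{x_j\}_{j\in J}$ be a frame for a separable real Hilbert space $\mathcal H$ with frame operator $S$. Let $\{P_N\}_{N\in\mathbb N}$ be a family of orthogonal projections $P_N:\mathcal H\to\mathcal H$ such that $\lim_{N\to\infty}P_N(u)=u$ for every $u\in\mathcal H$ and $P_{N}(\mathcal H)\subset P_{N+1}(\mathcal H)$ for every $N\in\mathbb N$; put $\mathcal H_N=P_N(\mathcal H)$. Given $f\in\mathcal H$, let $J_f(u)=\frac12\langle Su,u\rangle-\langle f,u\rangle$, let $v\in\mathcal H$ be the unique element with $J_f(v)\le J_f(u)$ for every $u\in\mathcal H$, and for each $N$ let $v_N\in\mathcal H_N$ be the unique element of $\mathcal H_N$ with $J_f(v_N)\le J_f(u)$ for every $u\in\mathcal H_N$. Then $$\lim_{N\to\infty}\|v_N-v\|=0 .$$ Equivalently, $$\lim_{N\to\infty}\big\|(P_NSP_N)^{-1}P_Nf-S^{-1}f\big\|=0 ,$$ where $(P_NSP_N)^{-1}$ denotes the inverse of $P_NSP_N$ regarded as an operator $\mathcal H_N\to\mathcal H_N$.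
   Context: $J\subset\mathbb N$ is a nonempty (finite or infinite) index set. A sequence of distinct vectors $\{x_j\}_{j\in J}$ in $\mathcal H$ is a frame if there are constants $A,B>0$ with $A\|x\|^2\le\sum_{j\in J}|\langle x,x_j\rangle|^2\le B\|x\|^2$ for all $x\in\mathcal H$. Its frame operator is $S:\mathcal H\to\mathcal H$, $Sx=\sum_{j\in J}\langle x,x_j\rangle x_j$, which is bounded, self-adjoint and invertible. The minimizers are $v=S^{-1}f$ and $v_N=(P_NSP_N)^{-1}P_Nf$, where $P_NSP_N$ is invertible as an operator on $\mathcal H_N$. *)

theory Defs
  imports "HOL-Analysis.Analysis"
begin

text \<open>
  The ambient real Hilbert space is a type of class \<open>real_inner\<close> and \<open>complete_space\<close>.
\<close>

text \<open>
  Distinctness of the vectors is injectivity of the family on \<open>J\<close>.  The summability clause is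
  part of the upper frame bound: \<open>infsum\<close> is \<open>0\<close> by convention when the sum diverges.
\<close>
definition is_frame :: "nat set \<Rightarrow> (nat \<Rightarrow> 'a::{real_inner,complete_space}) \<Rightarrow> bool" where
  "is_frame J x \<longleftrightarrow>
     J \<noteq> {} \<and> inj_on x J \<and>
     (\<exists>A B. 0 < A \<and> 0 < B \<and>
       (\<forall>u. (\<lambda>j. \<bar>u \<bullet> x j\<bar>\<^sup>2) summable_on J \<and>
            A * (norm u)\<^sup>2 \<le> (\<Sum>\<^sub>\<infinity>j\<in>J. \<bar>u \<bullet> x j\<bar>\<^sup>2) \<and>
            (\<Sum>\<^sub>\<infinity>j\<in>J. \<bar>u \<bullet> x j\<bar>\<^sup>2) \<le> B * (norm u)\<^sup>2))"

text \<open>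
  The series is summed unconditionally in norm; for a frame it does converge in that sense.
\<close>
definition frame_op :: "nat set \<Rightarrow> (nat \<Rightarrow> 'a::{real_inner,complete_space}) \<Rightarrow> 'a \<Rightarrow> 'a" where
  "frame_op J x u = (\<Sum>\<^sub>\<infinity>j\<in>J. (u \<bullet> x j) *\<^sub>R x j)"

definition orthogonal_projection :: "('a::{real_inner,complete_space} \<Rightarrow> 'a) \<Rightarrow> bool" where
  "orthogonal_projection P \<longleftrightarrow>
     bounded_linear P \<and> (\<forall>u. P (P u) = P u) \<and> (\<forall>u w. P u \<bullet> w = u \<bullet> P w)"

definition energy :: "('a \<Rightarrow> 'a) \<Rightarrow> 'a \<Rightarrow> 'a::{real_inner,complete_space} \<Rightarrow> real" where
  "energy S f u = 1/2 * (S u \<bullet> u) - f \<bullet> u"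

text \<open>
  The compression \<open>P S P\<close>, to be used only on \<open>range P\<close>; its inverse as an operator
  \<open>range P \<Rightarrow> range P\<close> is then \<open>inv_into (range P) (compression P S)\<close>.
\<close>
definition compression :: "('a \<Rightarrow> 'a) \<Rightarrow> ('a \<Rightarrow> 'a) \<Rightarrow> 'a \<Rightarrow> 'a" where
  "compression P S = P \<circ> S \<circ> P"

end

theory Submission
  imports Defs
begin

text \<open>
  The frame operator \<open>S\<close> is bounded, symmetric and, by the lower frame bound, coercive, so the
  theorem is the convergence of the Galerkin method for a symmetric coercive operator.

  Let \<open>P\<close> be an orthogonal projection. Coercivity survives compression to \<open>range P\<close>, whence the
  equation \<open>P (S w) = g\<close> has a solution \<open>w\<close> in \<open>range P\<close> for each \<open>g\<close> in \<open>range P\<close>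
  (\<open>coercive_operator.galerkin_solution\<close>, in the manner of Lax and Milgram). If \<open>g = P f\<close>, the
  residual \<open>S w - f\<close> is orthogonal to \<open>range P\<close>, and the energy of \<open>f\<close> grows quadratically away
  from \<open>w\<close> inside \<open>range P\<close> (\<open>coercive_operator.energy_galerkin\<close>). So \<open>w\<close> is the unique minimizer
  there, hence also the unique solution, and the variational and the operator descriptions of
  the approximants agree. The choice \<open>P = id\<close> gives the same for the whole space.

  Let \<open>v\<close> be the global minimizer and \<open>w\<close> the minimizer on \<open>range P\<close>. Then \<open>w\<close> beats the
  competitor \<open>P v\<close>. Since the excess of the energy over its minimum is half the quadratic form
  of \<open>S\<close> at the difference from \<open>v\<close>, comparable to the squared norm of that difference
  from both sides, \<open>norm (w - v)\<close> is at most a constant times \<open>norm (P v - v)\<close> (\<open>coercive_operator.quasi_optimality\<close>, Cea's lemma). The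
  constant does not depend on \<open>P\<close>, and \<open>P N v\<close> tends to \<open>v\<close>.

  The upper frame bound does the rest. By duality it controls the norm of finite linear
  combinations of the frame vectors by the square sum of the coefficients (\<open>synthesis_bound\<close>), so
  that the series for \<open>S\<close> converges unconditionally; and it bounds the quadratic form of \<open>S\<close>,
  hence \<open>S\<close> itself.
\<close>

section \<open>Bessel families and the frame operator\<close>

text \<open>
  Unconditional convergence follows from the Cauchy criterion: beyond a finite set that carries
  almost all of the sum of \<open>g\<close>, the partial sums of \<open>h\<close> can hardly move.
\<close>
lemma summable_on_square_comparison:
  fixes h :: "'i \<Rightarrow> 'a::{real_inner,complete_space}" and g :: "'i \<Rightarrow> real"
  assumes g: "g summable_on J" and nonneg: "\<And>j. j \<in> J \<Longrightarrow> 0 \<le> g j"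
    and B: "0 < B"
    and bound: "\<And>F. finite F \<Longrightarrow> F \<subseteq> J \<Longrightarrow> (norm (sum h F))\<^sup>2 \<le> B * sum g F"
  shows "h summable_on J"
proof -
  have "\<exists>Q. eventually Q (finite_subsets_at_top J) \<and>
            (\<forall>F G. Q F \<and> Q G \<longrightarrow> dist (sum h F) (sum h G) < e)" if e: "e > 0" for e
  proof -
    define d where "d = (e/2)\<^sup>2 / (2 * B)"
    have d: "d > 0" using e B by (simp add: d_def)
    obtain F0 where F0: "finite F0" "F0 \<subseteq> J" "dist (sum g F0) (infsum g J) \<le> d"
      using has_sum_finite_approximation[OF has_sum_infsum[OF g] d] by blast
    define Q where "Q F \<longleftrightarrow> finite F \<and> F0 \<subseteq> F \<and> F \<subseteq> J" for F
    have near: "dist (sum h F) (sum h F0) < e/2" if "Q F" for F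
    proof -
      have F: "finite F" "F0 \<subseteq> F" "F \<subseteq> J" using that by (auto simp: Q_def)
      have "sum g F \<le> infsum g J"
        using F g nonneg by (intro finite_sum_le_infsum) auto
      then have small: "sum g (F - F0) \<le> d"
        using F F0(3) by (simp add: sum_diff dist_real_def)
      have "(norm (sum h (F - F0)))\<^sup>2 \<le> B * sum g (F - F0)"
        using F by (intro bound) auto
      also have "\<dots> \<le> B * d"
        using small B by simp
      also have "\<dots> < (e/2)\<^sup>2"
        using e B by (simp add: d_def)
      finally have "norm (sum h (F - F0)) < e/2"
        using e power_less_imp_less_base[of _ 2 "e/2"] by simp
      then show ?thesis
        using F by (simp add: sum_diff dist_norm)
    qed
    have "dist (sum h F) (sum h G) < e" if "Q F" "Q G" for F G
      using dist_triangle_half_l[OF near[OF that(1)] near[OF that(2)]] .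
    moreover have "eventually Q (finite_subsets_at_top J)"
      unfolding eventually_finite_subsets_at_top Q_def using F0 by blast
    ultimately show ?thesis by blast
  qed
  then have "cauchy_filter (filtermap (sum h) (finite_subsets_at_top J))"
    by (simp add: cauchy_filter_metric_filtermap)
  moreover have "complete (UNIV :: 'a set)"
    by (meson Cauchy_convergent UNIV_I complete_def convergent_def)
  ultimately obtain s where "(sum h \<longlongrightarrow> s) (finite_subsets_at_top J)"
    using complete_uniform[where S=UNIV] by (force simp add: filterlim_def)
  then show ?thesis
    using summable_on_def has_sum_def by blast
qed

text \<open>
  The bound for the synthesis map is dual to the Bessel inequality: pair the combination \<open>y\<close> with
  itself and apply Cauchy--Schwarz, so that the Bessel inequality at \<open>y\<close> enters.
\<close>
lemma synthesis_bound:
  fixes x :: "'i \<Rightarrow> 'a::real_inner"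
  assumes B: "0 \<le> B"
    and bessel: "\<And>u. (\<Sum>j\<in>F. (u \<bullet> x j)\<^sup>2) \<le> B * (norm u)\<^sup>2"
  shows "(norm (\<Sum>j\<in>F. c j *\<^sub>R x j))\<^sup>2 \<le> B * (\<Sum>j\<in>F. (c j)\<^sup>2)"
proof -
  define y where "y = (\<Sum>j\<in>F. c j *\<^sub>R x j)"
  have "y \<bullet> y = (\<Sum>j\<in>F. c j * (y \<bullet> x j))"
    by (subst (2) y_def) (simp add: inner_sum_right)
  then have "(norm y)\<^sup>2 * (norm y)\<^sup>2 = (\<Sum>j\<in>F. c j * (y \<bullet> x j))\<^sup>2"
    unfolding power2_norm_eq_inner by (simp add: power2_eq_square)
  also have "\<dots> \<le> (\<Sum>j\<in>F. (c j)\<^sup>2) * (\<Sum>j\<in>F. (y \<bullet> x j)\<^sup>2)"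
    by (rule Cauchy_Schwarz_ineq_sum)
  also have "\<dots> \<le> (\<Sum>j\<in>F. (c j)\<^sup>2) * (B * (norm y)\<^sup>2)"
    by (intro mult_left_mono bessel sum_nonneg) auto
  finally have *: "(norm y)\<^sup>2 * (norm y)\<^sup>2 \<le> (B * (\<Sum>j\<in>F. (c j)\<^sup>2)) * (norm y)\<^sup>2"
    by (simp add: mult_ac)
  show ?thesis
  proof (cases "y = 0")
    case True
    then show ?thesis
      using B by (simp add: y_def[symmetric] sum_nonneg)
  next
    case False
    then show ?thesis
      using mult_right_le_imp_le[OF *] by (simp add: y_def)
  qed
qed

locale bessel_family =
  fixes J :: "nat set" and x :: "nat \<Rightarrow> 'a::{real_inner,complete_space}" and B :: real
  assumes B_pos: "0 < B"
    and square_summable: "(\<lambda>j. (u \<bullet> x j)\<^sup>2) summable_on J"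
    and bessel: "(\<Sum>\<^sub>\<infinity>j\<in>J. (u \<bullet> x j)\<^sup>2) \<le> B * (norm u)\<^sup>2"
begin

lemma frame_op_has_sum: "((\<lambda>j. (u \<bullet> x j) *\<^sub>R x j) has_sum frame_op J x u) J"
proof -
  have "(norm (\<Sum>j\<in>F. (u \<bullet> x j) *\<^sub>R x j))\<^sup>2 \<le> B * (\<Sum>j\<in>F. (u \<bullet> x j)\<^sup>2)"
    if F: "finite F" "F \<subseteq> J" for F
  proof (rule synthesis_bound)
    fix w
    have "(\<Sum>j\<in>F. (w \<bullet> x j)\<^sup>2) \<le> (\<Sum>\<^sub>\<infinity>j\<in>J. (w \<bullet> x j)\<^sup>2)"
      using F by (intro finite_sum_le_infsum square_summable) auto
    then show "(\<Sum>j\<in>F. (w \<bullet> x j)\<^sup>2) \<le> B * (norm w)\<^sup>2"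
      using bessel[of w] by linarith
  qed (use B_pos in simp)
  then have "(\<lambda>j. (u \<bullet> x j) *\<^sub>R x j) summable_on J"
    by (intro summable_on_square_comparison[OF square_summable[of u] _ B_pos]) auto
  then show ?thesis
    unfolding frame_op_def by (rule has_sum_infsum)
qed

lemma frame_op_inner_has_sum:
  "((\<lambda>j. (u \<bullet> x j) * (w \<bullet> x j)) has_sum (frame_op J x u \<bullet> w)) J"
  using has_sum_bounded_linear[OF bounded_linear_inner_left frame_op_has_sum, of u w]
  by (simp add: inner_commute[of w])

lemma frame_op_symmetric: "frame_op J x u \<bullet> w = u \<bullet> frame_op J x w"
proof -
  have "((\<lambda>j. (u \<bullet> x j) * (w \<bullet> x j)) has_sum (frame_op J x w \<bullet> u)) J"
    using frame_op_inner_has_sum[of w u] by (simp add: mult.commute)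
  then show ?thesis
    using frame_op_inner_has_sum[of u w] has_sum_unique by (metis inner_commute)
qed

lemma frame_op_quadratic_form: "frame_op J x u \<bullet> u = (\<Sum>\<^sub>\<infinity>j\<in>J. (u \<bullet> x j)\<^sup>2)"
  using frame_op_inner_has_sum[of u u] by (simp add: power2_eq_square infsumI)

lemma linear_frame_op: "linear (frame_op J x)"
proof (rule linearI)
  fix u w
  have "((\<lambda>j. ((u + w) \<bullet> x j) *\<^sub>R x j) has_sum (frame_op J x u + frame_op J x w)) J"
    using has_sum_add[OF frame_op_has_sum frame_op_has_sum, of u w]
    by (simp add: inner_add_left scaleR_add_left)
  then show "frame_op J x (u + w) = frame_op J x u + frame_op J x w"
    using frame_op_has_sum has_sum_unique by blast
next
  fix r :: real and u
  have "((\<lambda>j. ((r *\<^sub>R u) \<bullet> x j) *\<^sub>R x j) has_sum (r *\<^sub>R frame_op J x u)) J"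
    using has_sum_scaleR[OF frame_op_has_sum, of r u] by simp
  then show "frame_op J x (r *\<^sub>R u) = r *\<^sub>R frame_op J x u"
    using frame_op_has_sum has_sum_unique by blast
qed

text \<open>
  The quadratic form of \<open>S\<close> is nonnegative and at most \<open>B\<close> times the squared norm. Evaluating it
  at \<open>B u - S u\<close> turns these two bounds into one for \<open>norm (S u)\<close>.
\<close>
lemma frame_op_bound: "norm (frame_op J x u) \<le> B * norm u"
proof -
  let ?S = "frame_op J x"
  interpret linear ?S by (rule linear_frame_op)
  define y where "y = ?S u"
  have nonneg: "0 \<le> ?S z \<bullet> z" and upper: "?S z \<bullet> z \<le> B * (norm z)\<^sup>2" for z
    using bessel[of z] by (auto simp: frame_op_quadratic_form infsum_nonneg)
  have "?S (B *\<^sub>R u - y) \<bullet> (B *\<^sub>R u - y) = B\<^sup>2 * (?S u \<bullet> u) - 2 * B * (norm y)\<^sup>2 + ?S y \<bullet> y"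
    using frame_op_symmetric[of y u] unfolding power2_norm_eq_inner
    by (simp add: diff scaleR inner_diff_left inner_diff_right
        power2_eq_square y_def[symmetric] algebra_simps inner_commute)
  then have "2 * B * (norm y)\<^sup>2 \<le> B\<^sup>2 * (?S u \<bullet> u) + ?S y \<bullet> y"
    using nonneg[of "B *\<^sub>R u - y"] by simp
  also have "\<dots> \<le> B\<^sup>2 * (B * (norm u)\<^sup>2) + B * (norm y)\<^sup>2"
    by (intro add_mono mult_left_mono upper) auto
  finally have "B * (norm y)\<^sup>2 \<le> B * (B * norm u)\<^sup>2"
    by (simp add: power2_eq_square algebra_simps)
  then have "(norm y)\<^sup>2 \<le> (B * norm u)\<^sup>2"
    using B_pos by simp
  then show ?thesis
    unfolding y_def by (rule power2_le_imp_le) (use B_pos in simp)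
qed

lemma bounded_linear_frame_op: "bounded_linear (frame_op J x)"
  using linear_frame_op frame_op_bound
  by (intro bounded_linear_intro[of _ B]) (simp_all add: linear_add linear_scale mult.commute)

end

section \<open>Orthogonal projections\<close>

lemma orthogonal_projection_id: "orthogonal_projection (\<lambda>u. u)"
  by (simp add: orthogonal_projection_def)

lemma orthogonal_projection_range_iff:
  assumes "orthogonal_projection P"
  shows "w \<in> range P \<longleftrightarrow> P w = w"
proof
  show "P w = w" if "w \<in> range P"
    using that assms by (auto simp: orthogonal_projection_def)
  show "w \<in> range P" if "P w = w"
    using rangeI[of P w] that by simp
qed

lemma orthogonal_projection_norm_le:
  assumes "orthogonal_projection P"
  shows "norm (P u) \<le> norm u"
proof -
  have "(norm (P u))\<^sup>2 = u \<bullet> P u"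
    using assms by (simp add: orthogonal_projection_def power2_norm_eq_inner)
  also have "\<dots> \<le> norm u * norm (P u)"
    by (rule norm_cauchy_schwarz)
  finally show ?thesis
    by (cases "P u = 0") (simp_all add: power2_eq_square)
qed

section \<open>Galerkin approximation for symmetric coercive operators\<close>

locale coercive_operator =
  fixes S :: "'a::{real_inner,complete_space} \<Rightarrow> 'a" and A :: real
  assumes bounded_linear: "bounded_linear S"
    and symmetric: "S u \<bullet> w = u \<bullet> S w"
    and A_pos: "0 < A"
    and coercive: "A * (norm u)\<^sup>2 \<le> S u \<bullet> u"
begin

sublocale bounded_linear S by (rule bounded_linear)

text \<open>
  A damped Richardson iteration \<open>w \<mapsto> w - t (P (S w) - g)\<close> contracts \<open>range P\<close> if the step \<open>t\<close> is
  small. Precomposing it with \<open>P\<close> makes it a contraction of the whole space, which is complete,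
  and its fixed point lies in \<open>range P\<close> because every value of the map does.
\<close>
lemma galerkin_solution:
  assumes P: "orthogonal_projection P" and g: "P g = g"
  shows "\<exists>w. P w = w \<and> P (S w) = g"
proof -
  interpret P: bounded_linear P using P by (simp add: orthogonal_projection_def)
  have idem: "P (P u) = P u" and adj: "P u \<bullet> w = u \<bullet> P w" for u w
    using P by (auto simp: orthogonal_projection_def)
  obtain K where K: "K > 0" "\<And>u. norm (S u) \<le> norm u * K"
    using pos_bounded by blast
  \<comment> \<open>\<open>t\<close> nearly minimizes \<open>1 - 2 t A + t\<^sup>2 K\<^sup>2\<close>; the summand \<open>A\<^sup>2\<close> in the denominator keeps
     \<open>t A \<le> 1\<close> on the zero space too, where \<open>A \<le> K\<close> can fail.\<close>
  define t where "t = A / (K\<^sup>2 + A\<^sup>2)"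
  have den: "K\<^sup>2 + A\<^sup>2 > 0" using K(1) by (simp add: add_pos_nonneg)
  have t: "t > 0" using A_pos den by (simp add: t_def)
  have tA: "t * A \<le> 1" and tK: "t * K\<^sup>2 \<le> A"
    using den A_pos by (simp_all add: t_def divide_simps power2_eq_square algebra_simps)
  define c where "c = sqrt (1 - t * A)"
  have c: "0 \<le> c" "c < 1" using tA t A_pos by (auto simp: c_def)
  define T where "T w = P w - t *\<^sub>R (P (S (P w)) - g)" for w
  have contraction: "dist (T u) (T w) \<le> c * dist u w" for u w
  proof -
    define z where "z = P (u - w)"
    have Pz: "P z = z" by (simp add: z_def idem)
    have "T u - T w = z - t *\<^sub>R P (S z)"
      by (simp add: T_def z_def P.diff diff algebra_simps)
    then have "(dist (T u) (T w))\<^sup>2 = (norm (z - t *\<^sub>R P (S z)))\<^sup>2"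
      by (simp add: dist_norm)
    also have "\<dots> = (norm z)\<^sup>2 - 2 * t * (S z \<bullet> z) + t\<^sup>2 * (norm (P (S z)))\<^sup>2"
      using adj[of "S z" z] Pz unfolding power2_norm_eq_inner
      by (simp add: inner_diff_left inner_diff_right power2_eq_square
          algebra_simps inner_commute)
    also have "\<dots> \<le> (norm z)\<^sup>2 - 2 * t * (A * (norm z)\<^sup>2) + t\<^sup>2 * (K * norm z)\<^sup>2"
    proof -
      have "norm (P (S z)) \<le> K * norm z"
        using orthogonal_projection_norm_le[OF P, of "S z"] K(2)[of z]
        by (simp add: mult.commute)
      then have "t\<^sup>2 * (norm (P (S z)))\<^sup>2 \<le> t\<^sup>2 * (K * norm z)\<^sup>2"
        by (intro mult_left_mono power_mono) auto
      moreover have "2 * t * (A * (norm z)\<^sup>2) \<le> 2 * t * (S z \<bullet> z)"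
        using t coercive[of z] by simp
      ultimately show ?thesis by linarith
    qed
    also have "\<dots> = (1 - t * A) * (norm z)\<^sup>2 - t * (norm z)\<^sup>2 * (A - t * K\<^sup>2)"
      by (simp add: power2_eq_square algebra_simps)
    also have "\<dots> \<le> (1 - t * A) * (norm z)\<^sup>2"
      using t tK by simp
    also have "\<dots> \<le> (1 - t * A) * (norm (u - w))\<^sup>2"
      using tA orthogonal_projection_norm_le[OF P, of "u - w"]
      by (intro mult_left_mono power_mono) (auto simp: z_def)
    also have "\<dots> = (c * dist u w)\<^sup>2"
      using tA by (simp add: c_def power_mult_distrib dist_norm)
    finally show ?thesis
      by (rule power2_le_imp_le) (use c in simp)
  qed
  then have "\<exists>!w. T w = w"
    by (intro banach_fix_type[OF c]) blast
  then obtain w where w: "T w = w"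
    by blast
  have "P (T w) = T w"
    by (simp add: T_def P.diff P.scaleR idem g)
  then have "P w = w" by (simp add: w)
  moreover have "P (S w) = g"
    using w t \<open>P w = w\<close> by (simp add: T_def)
  ultimately show ?thesis by blast
qed

text \<open>
  Since \<open>S w - f\<close> is orthogonal to \<open>range P\<close>, the linear term in the expansion of the energy
  about \<open>w\<close> vanishes.
\<close>
lemma energy_galerkin:
  assumes P: "orthogonal_projection P" and w: "P w = w" "P (S w) = P f" and u: "P u = u"
  shows "energy S f u = energy S f w + 1/2 * (S (u - w) \<bullet> (u - w))"
proof -
  interpret P: bounded_linear P using P by (simp add: orthogonal_projection_def)
  have adj: "P a \<bullet> b = a \<bullet> P b" for a b
    using P by (auto simp: orthogonal_projection_def)
  have "(S w - f) \<bullet> (u - w) = (S w - f) \<bullet> P (u - w)"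
    by (simp add: P.diff w u)
  also have "\<dots> = P (S w - f) \<bullet> (u - w)"
    by (simp add: adj)
  also have "\<dots> = 0"
    by (simp add: P.diff w)
  finally have "(S w - f) \<bullet> (u - w) = 0" .
  then show ?thesis
    using symmetric[of u w]
    by (simp add: energy_def diff inner_diff_left inner_diff_right inner_commute field_simps)
qed

lemma energy_galerkin_lower:
  assumes "orthogonal_projection P" "P w = w" "P (S w) = P f" "P u = u"
  shows "energy S f w + A/2 * (norm (u - w))\<^sup>2 \<le> energy S f u"
  using energy_galerkin[OF assms] coercive[of "u - w"] by simp

lemma galerkin_is_minimizer:
  assumes "orthogonal_projection P" "P w = w" "P (S w) = P f" "P u = u"
  shows "energy S f w \<le> energy S f u"
proof -
  have "0 \<le> A/2 * (norm (u - w))\<^sup>2"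
    using A_pos by simp
  then show ?thesis
    using energy_galerkin_lower[OF assms] by linarith
qed

lemma galerkin_minimizer_unique:
  assumes "orthogonal_projection P" "P w = w" "P (S w) = P f" "P u = u"
    and "energy S f u \<le> energy S f w"
  shows "u = w"
proof -
  have "A/2 * (norm (u - w))\<^sup>2 \<le> 0"
    using energy_galerkin_lower[OF assms(1-4)] assms(5) by linarith
  then show ?thesis
    using A_pos by (simp add: mult_le_0_iff)
qed

lemma ex1_minimizer_on_range:
  assumes P: "orthogonal_projection P"
  shows "\<exists>!w. w \<in> range P \<and> (\<forall>u\<in>range P. energy S f w \<le> energy S f u)"
proof -
  have "P (P f) = P f"
    using P by (simp add: orthogonal_projection_def)
  then obtain w where w: "P w = w" "P (S w) = P f"
    using galerkin_solution[OF P] by blast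
  show ?thesis
  proof (rule ex1I[of _ w], goal_cases)
    case 1
    then show ?case
      using galerkin_is_minimizer[OF P w] w(1)
      by (auto simp: orthogonal_projection_range_iff[OF P])
  next
    case (2 u)
    then have "P u = u" "energy S f u \<le> energy S f (P w)"
      by (auto simp: orthogonal_projection_range_iff[OF P])
    then show ?case
      using galerkin_minimizer_unique[OF P w] w(1) by simp
  qed
qed

lemma arg_min_on_range_eq:
  assumes P: "orthogonal_projection P" and w: "P w = w" "P (S w) = P f"
  shows "arg_min_on (energy S f) (range P) = w"
  unfolding arg_min_on_def
proof (rule arg_minI)
  show "w \<in> range P"
    using w(1) by (simp add: orthogonal_projection_range_iff[OF P])
  show "\<not> energy S f u < energy S f w" if "u \<in> range P" for u
    using galerkin_is_minimizer[OF P w, of u] that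
    by (simp add: orthogonal_projection_range_iff[OF P] not_less)
  show "u = w" if "u \<in> range P" "\<forall>y. y \<in> range P \<longrightarrow> \<not> energy S f y < energy S f u" for u
    using galerkin_minimizer_unique[OF P w, of u] that \<open>w \<in> range P\<close>
    by (simp add: orthogonal_projection_range_iff[OF P] not_less)
qed

text \<open>
  Injectivity holds because a solution of \<open>P (S w) = g\<close> in \<open>range P\<close> minimizes the energy of
  \<open>g\<close> there, and the minimizer is unique.
\<close>
lemma bij_betw_compression:
  assumes P: "orthogonal_projection P"
  shows "bij_betw (compression P S) (range P) (range P)"
  unfolding bij_betw_def
proof
  note range_iff = orthogonal_projection_range_iff[OF P]
  have idem: "P (P u) = P u" for u
    using P by (auto simp: orthogonal_projection_def)
  have galerkin: "P (S w) = P (compression P S w)" if "w \<in> range P" for w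
    using that by (simp add: compression_def range_iff idem)
  show "inj_on (compression P S) (range P)"
  proof (rule inj_onI)
    fix u w
    assume u: "u \<in> range P" and w: "w \<in> range P"
      and eq: "compression P S u = compression P S w"
    have "u = arg_min_on (energy S (compression P S w)) (range P)"
      using arg_min_on_range_eq[OF P, of u] galerkin[OF u] u eq by (simp add: range_iff)
    also have "\<dots> = w"
      using arg_min_on_range_eq[OF P, of w] galerkin[OF w] w by (simp add: range_iff)
    finally show "u = w" .
  qed
  show "compression P S ` range P = range P"
  proof
    show "compression P S ` range P \<subseteq> range P"
      by (auto simp: compression_def)
    show "range P \<subseteq> compression P S ` range P"
    proof
      fix g assume "g \<in> range P"
      then obtain w where "P w = w" "P (S w) = g"
        using galerkin_solution[OF P] by (auto simp: range_iff)
      then show "g \<in> compression P S ` range P"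
        by (intro image_eqI[of _ _ w]) (simp_all add: compression_def range_iff)
    qed
  qed
qed

lemma inv_compression_eq_arg_min:
  assumes P: "orthogonal_projection P"
  shows "inv_into (range P) (compression P S) (P f) = arg_min_on (energy S f) (range P)"
proof -
  define w where "w = inv_into (range P) (compression P S) (P f)"
  have im: "compression P S ` range P = range P"
    using bij_betw_compression[OF P] by (simp add: bij_betw_def)
  then have Pf: "P f \<in> compression P S ` range P"
    by blast
  have "w \<in> range P" "compression P S w = P f"
    unfolding w_def by (rule inv_into_into[OF Pf], rule f_inv_into_f[OF Pf])
  then have "P w = w" "P (S w) = P f"
    by (simp_all add: compression_def orthogonal_projection_range_iff[OF P])
  then have "arg_min_on (energy S f) (range P) = w"
    by (rule arg_min_on_range_eq[OF P])
  then show ?thesis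
    by (simp only: w_def)
qed

lemma bij_operator: "bij S"
  using bij_betw_compression[OF orthogonal_projection_id]
  unfolding compression_def comp_def by simp

lemma inv_eq_arg_min: "inv S f = arg_min_on (energy S f) UNIV"
  using inv_compression_eq_arg_min[OF orthogonal_projection_id, of f]
  unfolding compression_def comp_def by simp

text \<open>
  The minimizer \<open>w\<close> on \<open>range P\<close> has at most the energy of \<open>P v\<close>, where \<open>v\<close> is the global
  minimizer; subtracting the energy of \<open>v\<close> leaves half the quadratic form of \<open>S\<close> at
  \<open>w - v\<close> and at \<open>P v - v\<close>, bounded below by coercivity and above by \<open>K\<close>.
\<close>
lemma quasi_optimality:
  fixes f :: 'a
  assumes P: "orthogonal_projection P" and K: "\<And>u. norm (S u) \<le> norm u * K"
  defines "v \<equiv> arg_min_on (energy S f) UNIV"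
  shows "norm (arg_min_on (energy S f) (range P) - v) \<le> sqrt (K / A) * norm (P v - v)"
proof -
  have idem: "P (P u) = P u" for u
    using P by (auto simp: orthogonal_projection_def)
  obtain w where w: "P w = w" "P (S w) = P f"
    using galerkin_solution[OF P idem] by blast
  have argmin: "arg_min_on (energy S f) (range P) = w"
    by (rule arg_min_on_range_eq[OF P w])
  have Sv: "S v = f"
    unfolding v_def inv_eq_arg_min[symmetric]
    by (rule surj_f_inv_f[OF bij_is_surj[OF bij_operator]])
  note expand = energy_galerkin[OF orthogonal_projection_id refl Sv refl]
  define d where "d = P v - v"
  have "energy S f w \<le> energy S f (P v)"
    by (rule galerkin_is_minimizer[OF P w idem])
  then have "S (w - v) \<bullet> (w - v) \<le> S d \<bullet> d"
    using expand[of w] expand[of "P v"] by (simp add: d_def)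
  then have "A * (norm (w - v))\<^sup>2 \<le> S d \<bullet> d"
    using coercive[of "w - v"] by linarith
  also have "\<dots> \<le> norm (S d) * norm d"
    by (rule norm_cauchy_schwarz)
  also have "\<dots> \<le> K * (norm d)\<^sup>2"
    using mult_right_mono[OF K[of d], of "norm d"] by (simp add: power2_eq_square mult_ac)
  finally have "(norm (w - v))\<^sup>2 \<le> K / A * (norm d)\<^sup>2"
    using A_pos by (simp add: field_simps)
  then have "norm (w - v) \<le> sqrt (K / A * (norm d)\<^sup>2)"
    by (rule real_le_rsqrt)
  then show ?thesis
    by (simp only: argmin d_def real_sqrt_mult real_sqrt_abs abs_norm_cancel)
qed

lemma galerkin_convergence:
  assumes P: "\<And>N. orthogonal_projection (P N)" and lim: "\<And>u. (\<lambda>N. P N u) \<longlonglongrightarrow> u"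
  shows "(\<lambda>N. norm (arg_min_on (energy S f) (range (P N)) - arg_min_on (energy S f) UNIV))
           \<longlonglongrightarrow> 0"
proof -
  define v where "v = arg_min_on (energy S f) UNIV"
  obtain K where K: "\<And>u. norm (S u) \<le> norm u * K"
    using bounded by blast
  have "(\<lambda>N. P N v - v) \<longlonglongrightarrow> 0"
    using lim[of v] by (simp add: LIM_zero)
  then have "(\<lambda>N. sqrt (K / A) * norm (P N v - v)) \<longlonglongrightarrow> 0"
    by (intro tendsto_mult_right_zero tendsto_norm_zero)
  then show ?thesis
    by (rule tendsto_sandwich[OF _ _ tendsto_const, rotated 2])
       (use quasi_optimality[OF P K] in \<open>simp_all add: v_def\<close>)
qed

end

section \<open>Galerkin approximation of the inverse frame operator\<close>

lemma frame_op_coercive_operator: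
  assumes "is_frame J x"
  shows "\<exists>A. coercive_operator (frame_op J x) A"
proof -
  obtain A B where AB: "0 < A" "0 < B"
    and frame: "\<And>u. (\<lambda>j. (u \<bullet> x j)\<^sup>2) summable_on J"
      "\<And>u. A * (norm u)\<^sup>2 \<le> (\<Sum>\<^sub>\<infinity>j\<in>J. (u \<bullet> x j)\<^sup>2)"
      "\<And>u. (\<Sum>\<^sub>\<infinity>j\<in>J. (u \<bullet> x j)\<^sup>2) \<le> B * (norm u)\<^sup>2"
    using assms unfolding is_frame_def power2_abs by blast
  interpret bessel_family J x B
    using AB frame by unfold_locales
  have "coercive_operator (frame_op J x) A"
  proof (rule coercive_operator.intro)
    show "A * (norm u)\<^sup>2 \<le> frame_op J x u \<bullet> u" for u
      using frame(2)[of u] by (simp add: frame_op_quadratic_form)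
  qed (rule bounded_linear_frame_op frame_op_symmetric AB(1))+
  then show ?thesis by blast
qed

theorem theorem4p1:
  fixes J :: "nat set"
    and x :: "nat \<Rightarrow> 'a::{real_inner,complete_space}"
    and S :: "'a \<Rightarrow> 'a"
    and P :: "nat \<Rightarrow> 'a \<Rightarrow> 'a"
    and H :: "nat \<Rightarrow> 'a set"
    and f :: 'a
  assumes separable: "separable_space (euclidean :: 'a topology)"
    and frame: "is_frame J x"
    and S_def: "S = frame_op J x"
    and proj: "\<And>N. orthogonal_projection (P N)"
    and lim: "\<And>u. (\<lambda>N. P N u) \<longlonglongrightarrow> u"
    and H_def: "\<And>N. H N = range (P N)"
    and nested: "\<And>N. H N \<subseteq> H (Suc N)"
  shows "(\<exists>!v. \<forall>u. energy S f v \<le> energy S f u)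
    \<and> (\<forall>N. \<exists>!w. w \<in> H N \<and> (\<forall>u\<in>H N. energy S f w \<le> energy S f u))
    \<and> (\<lambda>N. norm (arg_min_on (energy S f) (H N) - arg_min_on (energy S f) UNIV)) \<longlonglongrightarrow> 0
    \<and> bij S
    \<and> (\<forall>N. bij_betw (compression (P N) S) (H N) (H N))
    \<and> (\<lambda>N. norm (inv_into (H N) (compression (P N) S) (P N f) - inv S f)) \<longlonglongrightarrow> 0"
proof -
  obtain A where "coercive_operator S A"
    using frame_op_coercive_operator[OF frame] S_def by blast
  then interpret coercive_operator S A .
  have min: "\<exists>!v. \<forall>u. energy S f v \<le> energy S f u"
    using ex1_minimizer_on_range[OF orthogonal_projection_id, of f] by simp
  have conv: "(\<lambda>N. norm (arg_min_on (energy S f) (range (P N))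
      - arg_min_on (energy S f) UNIV)) \<longlonglongrightarrow> 0"
    by (rule galerkin_convergence[OF proj lim])
  show ?thesis
    unfolding H_def inv_compression_eq_arg_min[OF proj] inv_eq_arg_min
    by (intro conjI allI min conv ex1_minimizer_on_range proj bij_operator bij_betw_compression)
qed

end
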